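(* Let $K\subseteq\mathbb{R}^m$ be a closed convex set and let $F:K\to\mathbb{R}^m$ be Lipschitz continuous with a constant $L>0$. Assume that $\mathrm{Sol}(K,F)$ is nonempty and that there is $\eta>0$ such that for every $x\in K$ there is $v_x^*\in S(x)$ with $$\langle F(x)-F(v_x^* ),x-v_x^*\rangle\ge\eta\,\mathrm{dist}^2(x,\mathrm{Sol}(K,F)),$$ where $S(x)$ is the set of points of $\mathrm{cl}(\mathrm{Sol}(K,F))$ that attain the distance from $x$ to $\mathrm{cl}(\mathrm{Sol}(K,F))$. Let $0<\alpha<\min\{\frac{\eta}{L^2},\frac{1}{2L}\}$. Then the set $\{(x^*,x^* )\mid x^*\in\mathrm{Sol}(K,F)\}$ is exponentially stable for the system $$\dot y=\Pi_K[x-\alpha F(x)]-y,\qquad \dot x=\Pi_K[x-\alpha F(y)]-x,$$ initialized at any $x(0),y(0)\in K$.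
   Context: $\mathrm{Sol}(K,F)=\{x^*\in K\mid \langle F(x^* ),x-x^*\rangle\ge 0\ \text{for all }x\in K\}$. $\Pi_K$ is the Euclidean projection onto the closed convex set $K$; $\|\cdot\|$ is the Euclidean norm; $\mathrm{dist}(x,M)=\inf_{y\in M}\|x-y\|$; $\mathrm{cl}$ denotes closure. For a system $\dot z=f(z)$ with domain $\mathrm{dom}(f)$ (here $\mathrm{dom}(f)=K\times K$): a set $M$ is positively invariant if $z(0)\in M$ implies $z(t)\in M$ for all $t\ge0$. A closed positively invariant set $M$ is exponentially stable if there are constants $\beta_1,\beta_2,\beta_3>0$ such that for all $z(0)\in\mathrm{dom}(f)$ with $\mathrm{dist}(z(0),M)\le\beta_3$ one has $\mathrm{dist}(z(t),M)\le\beta_1\,\mathrm{dist}(z(0),M)e^{-\beta_2 t}$ for all $t\ge0$. Standing assumption: the vector field is continuous and the system has a unique solution on $[0,+\infty)$ for every initial point in $\mathrm{dom}(f)$. *)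

theory Defs
  imports "HOL-Analysis.Analysis"
begin

definition VI_Sol :: "'a::real_inner set \<Rightarrow> ('a \<Rightarrow> 'a) \<Rightarrow> 'a set" where
  "VI_Sol K F = {xs \<in> K. \<forall>x\<in>K. F xs \<bullet> (x - xs) \<ge> 0}"

definition nearest_points :: "'a::metric_space set \<Rightarrow> 'a \<Rightarrow> 'a set" where
  "nearest_points A x = {v \<in> A. dist x v = infdist x A}"

text \<open>Forward solutions of \<open>z' = f z\<close>, where \<open>f\<close> is meaningful only on \<open>D\<close>; a solution
  therefore has to stay in \<open>D\<close>. At time \<open>0\<close> the derivative is one-sided, and values of \<open>z\<close> at
  negative times are irrelevant.\<close>

definition is_solution ::
    "('a::real_normed_vector \<Rightarrow> 'a) \<Rightarrow> 'a set \<Rightarrow> (real \<Rightarrow> 'a) \<Rightarrow> bool" where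
  "is_solution f D z \<longleftrightarrow>
     (\<forall>t\<ge>0. z t \<in> D \<and> (z has_vector_derivative f (z t)) (at t within {0..}))"

text \<open>Both notions below speak about every solution with the given initial value, so they make
  sense without presupposing uniqueness. If solutions are unique, they are the usual ones.\<close>

definition positively_invariant ::
    "('a::real_normed_vector \<Rightarrow> 'a) \<Rightarrow> 'a set \<Rightarrow> 'a set \<Rightarrow> bool" where
  "positively_invariant f D M \<longleftrightarrow>
     (\<forall>z. is_solution f D z \<and> z 0 \<in> M \<longrightarrow> (\<forall>t\<ge>0. z t \<in> M))"

definition exponentially_stable ::
    "('a::real_normed_vector \<Rightarrow> 'a) \<Rightarrow> 'a set \<Rightarrow> 'a set \<Rightarrow> bool" where
  "exponentially_stable f D M \<longleftrightarrow>
     closed M \<and> positively_invariant f D M \<and>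
     (\<exists>\<beta>1>0. \<exists>\<beta>2>0. \<exists>\<beta>3>0. \<forall>z. is_solution f D z \<and> infdist (z 0) M \<le> \<beta>3 \<longrightarrow>
        (\<forall>t\<ge>0. infdist (z t) M \<le> \<beta>1 * infdist (z 0) M * exp (- \<beta>2 * t)))"

text \<open>The state is the pair \<open>(y, x)\<close>. The norm of the product type is the Euclidean one, and
  \<open>closest_point K\<close> is the projection onto the closed convex set \<open>K\<close>.\<close>

definition extragradient_field ::
    "'a::euclidean_space set \<Rightarrow> ('a \<Rightarrow> 'a) \<Rightarrow> real \<Rightarrow> 'a \<times> 'a \<Rightarrow> 'a \<times> 'a" where
  "extragradient_field K F \<alpha> = (\<lambda>(y, x).
     (closest_point K (x - \<alpha> *\<^sub>R F x) - y, closest_point K (x - \<alpha> *\<^sub>R F y) - x))"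

end

theory Submission
  imports Defs
begin

text \<open>Let \<open>d\<close> be the distance of \<open>x\<close> to the solution set and \<open>e = norm (y - x)\<close>. Since the
  projection is nonexpansive, \<open>e\<close> decays exponentially on its own. The error bound, applied at a
  nearest solution, makes the derivative of \<open>d\<^sup>2\<close> at most \<open>- (\<alpha> * \<eta> / 2) * d\<^sup>2 + (9 / 4) * e\<^sup>2\<close>.
  Hence \<open>d\<^sup>2 + 5 * e\<^sup>2\<close> is a Lyapunov function. The solution set need not be convex, so \<open>d\<^sup>2\<close> need
  not be differentiable; it is replaced at each time by the squared distance to a fixed nearest
  solution, which dominates \<open>d\<^sup>2\<close> and agrees with it at that time.\<close>

section \<open>Monotonicity without differentiability\<close>

text \<open>After an arbitrarily small downward tilt, the majorant touching \<open>G\<close> at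
  \<open>t\<close> decreases strictly just after \<open>t\<close> and drags \<open>G\<close> down
  with it. So there is no last time at which the tilted function is still at most its initial value,
  short of \<open>T\<close> itself.\<close>

lemma nonincreasing_if_touching_majorant:
  fixes G :: "real \<Rightarrow> real"
  assumes cont: "continuous_on {0..} G"
    and major: "\<And>t. t \<ge> 0 \<Longrightarrow> \<exists>U D. U t = G t \<and> (\<forall>s\<ge>0. G s \<le> U s) \<and>
                  (U has_real_derivative D) (at t within {0..}) \<and> D \<le> 0"
    and "T \<ge> 0"
  shows "G T \<le> G 0"
proof (rule field_le_epsilon)
  fix \<delta> :: real assume "\<delta> > 0"
  \<comment> \<open>Dividing by \<open>T + 1\<close> rather than \<open>T\<close> also covers
    \<open>T = 0\<close>.\<close>
  define \<epsilon> where "\<epsilon> = \<delta> / (T + 1)"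
  have \<epsilon>: "\<epsilon> > 0" "\<epsilon> * T \<le> \<delta>"
    using \<open>\<delta> > 0\<close> \<open>T \<ge> 0\<close> by (auto simp: \<epsilon>_def field_simps)
  define H where "H s = G s - \<epsilon> * s" for s
  have "H T \<le> H 0"
  proof (rule ccontr)
    assume neg: "\<not> H T \<le> H 0"
    define A where "A = {s \<in> {0..T}. H s \<le> H 0}"
    have "continuous_on {0..T} H"
      unfolding H_def
      by (intro continuous_intros continuous_on_subset[OF cont]) auto
    then have "closed A"
      unfolding A_def by (intro continuous_on_closed_Collect_le) auto
    moreover have "bounded A"
      unfolding A_def by (rule bounded_subset[of "{0..T}"]) auto
    ultimately have "compact A"
      by (simp add: compact_eq_bounded_closed)
    moreover have "0 \<in> A"
      using \<open>T \<ge> 0\<close> by (simp add: A_def)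
    ultimately obtain t where t: "t \<in> A" "\<And>s. s \<in> A \<Longrightarrow> s \<le> t"
      using compact_attains_sup[of A] by blast
    then have "0 \<le> t" "t \<le> T" "H t \<le> H 0"
      by (auto simp: A_def)
    then have "t < T"
      using neg by (cases "t = T") auto
    obtain U D where U: "U t = G t" "\<And>s. s \<ge> 0 \<Longrightarrow> G s \<le> U s"
      "(U has_real_derivative D) (at t within {0..})" "D \<le> 0"
      using major[OF \<open>0 \<le> t\<close>] by blast
    have "((\<lambda>s. U s - \<epsilon> * s) has_real_derivative D - \<epsilon>) (at t within {0..})"
      by (auto intro!: derivative_eq_intros U)
    moreover have "D - \<epsilon> < 0"
      using U \<epsilon> by simp
    ultimately obtain r where r: "r > 0"
      "\<And>h. h > 0 \<Longrightarrow> t + h \<in> {0..} \<Longrightarrow> h < r \<Longrightarrow> U (t + h) - \<epsilon> * (t + h) < U t - \<epsilon> * t"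
      using has_real_derivative_neg_dec_right by blast
    \<comment> \<open>Halving \<open>r\<close> makes \<open>h < r\<close> strict; the other bound
      keeps \<open>t + h\<close> in the interval on which \<open>A\<close> is defined.\<close>
    define h where "h = min (r / 2) (T - t)"
    have h: "h > 0" "h < r" "t + h \<le> T"
      using r(1) \<open>t < T\<close> by (auto simp: h_def min_def)
    have "H (t + h) < H t"
      using r(2)[of h] U(1) U(2)[of "t + h"] h \<open>0 \<le> t\<close> by (simp add: H_def)
    then have "t + h \<in> A"
      using h \<open>0 \<le> t\<close> \<open>H t \<le> H 0\<close> by (simp add: A_def)
    then show False
      using t(2)[of "t + h"] h by simp
  qed
  then show "G T \<le> G 0 + \<delta>"
    using \<epsilon> by (simp add: H_def)
qed

lemma has_real_derivative_norm_square:
  fixes f :: "real \<Rightarrow> 'a::real_inner"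
  assumes "(f has_vector_derivative f') (at t within S)"
  shows "((\<lambda>s. (norm (f s))\<^sup>2) has_real_derivative 2 * (f' \<bullet> f t)) (at t within S)"
  using assms unfolding power2_norm_eq_inner has_vector_derivative_def has_field_derivative_def
  by (auto intro!: derivative_eq_intros simp: inner_commute)

text \<open>Each test point \<open>x\<close> imposes a closed condition on \<open>xs\<close>.
  Closedness makes the nearest points of the closure genuine solutions, so the variational
  inequality is available at them.\<close>

lemma closed_VI_Sol:
  fixes K :: "'a::real_inner set"
  assumes "closed K" "continuous_on K F"
  shows "closed (VI_Sol K F)"
proof -
  have "closed {xs \<in> K. 0 \<le> F xs \<bullet> (x - xs)}" for x
    using assms by (intro continuous_on_closed_Collect_le continuous_intros) auto
  \<comment> \<open>The outer \<open>K\<close> matters when \<open>K\<close> is empty, since the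
    inner intersection is then the whole space.\<close>
  then have "closed (K \<inter> (\<Inter>x\<in>K. {xs \<in> K. 0 \<le> F xs \<bullet> (x - xs)}))"
    using assms by auto
  moreover have "VI_Sol K F = K \<inter> (\<Inter>x\<in>K. {xs \<in> K. 0 \<le> F xs \<bullet> (x - xs)})"
    by (auto simp: VI_Sol_def)
  ultimately show ?thesis by simp
qed

section \<open>Estimates for the two projection steps\<close>

text \<open>The left side is the derivative of the squared gap along the flow. The gap moves with
  velocity \<open>(p - q) - (y - x)\<close>, and nonexpansiveness gives \<open>norm (p - q)\<close>
  at most half of \<open>norm (y - x)\<close>, so the damping term wins.\<close>

lemma projection_step_gap:
  fixes K :: "'a::euclidean_space set"
  assumes "closed K" "convex K" "L-lipschitz_on K F" "\<alpha> > 0" "\<alpha> * L \<le> 1 / 2"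
    and K: "x \<in> K" "y \<in> K"
  defines "p \<equiv> closest_point K (x - \<alpha> *\<^sub>R F x)" and "q \<equiv> closest_point K (x - \<alpha> *\<^sub>R F y)"
  shows "2 * (((p - y) - (q - x)) \<bullet> (y - x)) \<le> - (norm (y - x))\<^sup>2"
proof -
  have "norm (p - q) \<le> norm ((x - \<alpha> *\<^sub>R F x) - (x - \<alpha> *\<^sub>R F y))"
    using closest_point_lipschitz[of K "x - \<alpha> *\<^sub>R F x" "x - \<alpha> *\<^sub>R F y"] assms
    by (auto simp: dist_norm)
  also have "\<dots> = \<alpha> * norm (F y - F x)"
    using \<open>\<alpha> > 0\<close> by (simp flip: scaleR_diff_right)
  also have "\<dots> \<le> \<alpha> * (L * norm (y - x))"
    using lipschitz_on_normD[OF assms(3) K(2,1)] \<open>\<alpha> > 0\<close> by simp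
  also have "\<dots> \<le> 1 / 2 * norm (y - x)"
    using mult_right_mono[OF assms(5), of "norm (y - x)"] by (simp add: mult.assoc)
  finally have "norm (p - q) * norm (y - x) \<le> 1 / 2 * (norm (y - x))\<^sup>2"
    unfolding power2_eq_square mult.assoc[symmetric] by (rule mult_right_mono) simp
  then have "(p - q) \<bullet> (y - x) \<le> 1 / 2 * (norm (y - x))\<^sup>2"
    using norm_cauchy_schwarz[of "p - q" "y - x"] by linarith
  moreover have "((p - y) - (q - x)) \<bullet> (y - x) = (p - q) \<bullet> (y - x) - (norm (y - x))\<^sup>2"
    by (simp add: power2_norm_eq_inner algebra_simps)
  ultimately show ?thesis by simp
qed

text \<open>The left side is the derivative of the squared distance to the fixed solution
  \<open>v\<close>. Testing the projection inequality for \<open>q\<close> with \<open>v\<close>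
  produces \<open>F y \<bullet> (q - v)\<close>, where the error bound supplies the decay in
  \<open>x - v\<close>. The remainders are Lipschitz terms, absorbed by Young's inequality with the
  help of \<open>- (norm (q - x))\<^sup>2\<close>.\<close>

lemma projection_step_toward_solution:
  fixes K :: "'a::euclidean_space set"
  assumes "closed K" "convex K" "L-lipschitz_on K F" "\<eta> > 0" "\<alpha> > 0"
    and \<alpha>: "\<alpha> * L \<le> 1 / 2" "\<alpha> * L\<^sup>2 \<le> \<eta>"
    and K: "x \<in> K" "y \<in> K" and v: "v \<in> VI_Sol K F"
    and err: "(F x - F v) \<bullet> (x - v) \<ge> \<eta> * (norm (x - v))\<^sup>2"
  defines "q \<equiv> closest_point K (x - \<alpha> *\<^sub>R F y)"
  shows "2 * ((q - x) \<bullet> (x - v)) \<le> - (\<alpha> * \<eta> / 2) * (norm (x - v))\<^sup>2 + 9 / 4 * (norm (y - x))\<^sup>2"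
proof -
  have L: "L \<ge> 0"
    using assms(3) by (rule lipschitz_on_nonneg)
  have vK: "v \<in> K" and sol: "\<And>u. u \<in> K \<Longrightarrow> F v \<bullet> (u - v) \<ge> 0"
    using v by (auto simp: VI_Sol_def)
  have qK: "q \<in> K"
    unfolding q_def using assms(1) K by (intro closest_point_in_set) auto
  define d s e where "d = norm (x - v)" and "s = norm (q - x)" and "e = norm (y - x)"
  have nn: "d \<ge> 0" "s \<ge> 0" "e \<ge> 0"
    by (auto simp: d_def s_def e_def)
  have proj: "(x - \<alpha> *\<^sub>R F y - q) \<bullet> (v - q) \<le> 0"
    unfolding q_def using closest_point_dot[OF assms(2,1) vK] .
  have Fxv: "(F x - F v) \<bullet> (q - x) \<ge> - (L * d * s)"
  proof -
    have "- ((F x - F v) \<bullet> (q - x)) \<le> norm (F x - F v) * norm (q - x)"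
      by (metis norm_cauchy_schwarz inner_minus_left norm_minus_cancel)
    also have "\<dots> \<le> L * d * s"
      unfolding d_def s_def
      by (intro mult_right_mono lipschitz_on_normD[OF assms(3)] K vK) auto
    finally show ?thesis by simp
  qed
  have Fyx: "(F y - F x) \<bullet> (q - v) \<ge> - (L * e * (s + d))"
  proof -
    have "- ((F y - F x) \<bullet> (q - v)) \<le> norm (F y - F x) * norm (q - v)"
      by (metis norm_cauchy_schwarz inner_minus_left norm_minus_cancel)
    also have "\<dots> \<le> (L * e) * (s + d)"
      unfolding d_def s_def e_def
      using norm_triangle_ineq[of "q - x" "x - v"] L
      by (intro mult_mono lipschitz_on_normD[OF assms(3)] K) auto
    finally show ?thesis by simp
  qed
  \<comment> \<open>\<open>F y\<close> is telescoped through \<open>F x\<close> and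
    \<open>F v\<close>, and \<open>q - v\<close> is split at \<open>x\<close> in the middle
    difference, to expose the error-bound term.\<close>
  have "F y \<bullet> (q - v) = (F y - F x) \<bullet> (q - v) + (F x - F v) \<bullet> (q - x)
      + (F x - F v) \<bullet> (x - v) + F v \<bullet> (q - v)"
    by (simp add: algebra_simps)
  then have "F y \<bullet> (q - v) \<ge> \<eta> * d\<^sup>2 - L * d * s - L * e * (s + d)"
    using Fxv Fyx err sol[OF qK] by (simp add: d_def)
  then have Fy: "\<alpha> * (F y \<bullet> (q - v)) \<ge> \<alpha> * (\<eta> * d\<^sup>2 - L * d * s - L * e * (s + d))"
    using \<open>\<alpha> > 0\<close> by simp
  have "(q - x) \<bullet> (x - v) = - (\<alpha> * (F y \<bullet> (q - v))) - s\<^sup>2 + (x - \<alpha> *\<^sub>R F y - q) \<bullet> (v - q)"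
    unfolding s_def power2_norm_eq_inner by (simp add: algebra_simps inner_commute)
  with proj Fy have 1: "(q - x) \<bullet> (x - v) \<le>
      - (\<alpha> * \<eta>) * d\<^sup>2 + (\<alpha> * L) * d * s + (\<alpha> * L) * e * s + (\<alpha> * L) * e * d - s\<^sup>2"
    by (simp add: algebra_simps)
  define a where "a = \<alpha> * L"
  have a: "a \<ge> 0" "a \<le> 1 / 2" "a\<^sup>2 \<le> \<alpha> * \<eta>"
    using \<alpha> L \<open>\<alpha> > 0\<close> mult_left_mono[OF \<alpha>(2), of \<alpha>]
    by (auto simp: a_def power_mult_distrib power2_eq_square mult_ac)
  \<comment> \<open>The weights are chosen so that \<open>2\<close> and \<open>3\<close> use up
    exactly \<open>s\<^sup>2\<close>, while \<open>2\<close> and \<open>4\<close> together cost 3/4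
    of \<open>a\<^sup>2 * d\<^sup>2\<close>, leaving a quarter of
    \<open>\<alpha> * \<eta> * d\<^sup>2\<close>. The terms in \<open>e\<close> add up to 1/8 + 1 =
    9/8. Doubling gives the stated coefficients.\<close>
  have 2: "a * d * s \<le> a\<^sup>2 * d\<^sup>2 / 2 + s\<^sup>2 / 2"
    using sum_squares_bound[of "a * d" s] by (simp add: power_mult_distrib)
  have 3: "a * e * s \<le> a\<^sup>2 * e\<^sup>2 / 2 + s\<^sup>2 / 2"
    using sum_squares_bound[of "a * e" s] by (simp add: power_mult_distrib)
  have 4: "a * e * d \<le> a\<^sup>2 * d\<^sup>2 / 4 + e\<^sup>2"
    using sum_squares_bound[of "a * d / 2" e] by (simp add: power_mult_distrib power_divide mult_ac)
  have 5: "a\<^sup>2 * d\<^sup>2 \<le> \<alpha> * \<eta> * d\<^sup>2"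
    using a by (intro mult_right_mono) auto
  have 6: "a\<^sup>2 * e\<^sup>2 \<le> 1 / 4 * e\<^sup>2"
    using power_mono[OF a(2,1), of 2] by (intro mult_right_mono) (auto simp: power2_eq_square)
  show ?thesis
    using 1 2 3 4 5 6 unfolding a_def[symmetric] d_def[symmetric] e_def[symmetric] by simp
qed

section \<open>Decay of the Lyapunov function\<close>

lemma lyapunov_decay:
  fixes K :: "'a::euclidean_space set"
  assumes "closed K" "convex K" and lip: "L-lipschitz_on K F" and "\<eta> > 0" "\<alpha> > 0"
    and \<alpha>: "\<alpha> * L \<le> 1 / 2" "\<alpha> * L\<^sup>2 \<le> \<eta>"
    and ne: "VI_Sol K F \<noteq> {}"
    and err: "\<And>x. x \<in> K \<Longrightarrow> \<exists>v \<in> VI_Sol K F. dist x v = infdist x (VI_Sol K F) \<and>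
           (F x - F v) \<bullet> (x - v) \<ge> \<eta> * (infdist x (VI_Sol K F))\<^sup>2"
    and sol: "is_solution (extragradient_field K F \<alpha>) (K \<times> K) z"
  defines "V \<equiv> \<lambda>(y, x). (infdist x (VI_Sol K F))\<^sup>2 + 5 * (norm (y - x))\<^sup>2"
    and "\<mu> \<equiv> min (\<alpha> * \<eta> / 2) (1 / 2)"
  assumes "T \<ge> 0"
  shows "V (z T) \<le> V (z 0) * exp (- \<mu> * T)"
proof -
  let ?S = "VI_Sol K F"
  define x y where "x = (\<lambda>t. snd (z t))" and "y = (\<lambda>t. fst (z t))"
  have z: "z t = (y t, x t)" for t
    by (simp add: x_def y_def)
  have K: "x t \<in> K" "y t \<in> K" if "t \<ge> 0" for t
    using sol that by (auto simp: is_solution_def x_def y_def mem_Times_iff)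
  define p q where "p t = closest_point K (x t - \<alpha> *\<^sub>R F (x t))"
    and "q t = closest_point K (x t - \<alpha> *\<^sub>R F (y t))" for t
  have dz: "(z has_vector_derivative (p t - y t, q t - x t)) (at t within {0..})" if "t \<ge> 0" for t
    using sol that by (auto simp: is_solution_def extragradient_field_def p_def q_def z)
  have dx: "(x has_vector_derivative q t - x t) (at t within {0..})"
    and dy: "(y has_vector_derivative p t - y t) (at t within {0..})" if "t \<ge> 0" for t
    using bounded_linear.has_vector_derivative[OF bounded_linear_snd dz[OF that]]
      bounded_linear.has_vector_derivative[OF bounded_linear_fst dz[OF that]]
    by (auto simp: x_def y_def)
  have cont: "continuous_on {0..} x" "continuous_on {0..} y"
    using dx dy by (auto simp: continuous_on_eq_continuous_within
        intro!: has_vector_derivative_continuous)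
  \<comment> \<open>The exponential factor turns decay of \<open>V\<close> at rate
    \<open>\<mu>\<close> into monotonicity of \<open>G\<close>.\<close>
  define G where "G t = exp (\<mu> * t) * V (z t)" for t
  have "G T \<le> G 0"
  proof (rule nonincreasing_if_touching_majorant[OF _ _ \<open>T \<ge> 0\<close>])
    show "continuous_on {0..} G"
      unfolding G_def V_def z split_conv using cont by (intro continuous_intros)
  next
    fix t :: real assume t: "t \<ge> 0"
    obtain v where v: "v \<in> ?S" "dist (x t) v = infdist (x t) ?S"
      "(F (x t) - F v) \<bullet> (x t - v) \<ge> \<eta> * (infdist (x t) ?S)\<^sup>2"
      using err[OF K(1)[OF t]] by blast
    \<comment> \<open>\<open>V\<close> along the trajectory with the nearest solution frozen at the
      one chosen for time \<open>t\<close>.\<close>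
    define W where "W s = (norm (x s - v))\<^sup>2 + 5 * (norm (y s - x s))\<^sup>2" for s
    define D where "D = 2 * ((q t - x t) \<bullet> (x t - v))
      + 5 * (2 * (((p t - y t) - (q t - x t)) \<bullet> (y t - x t)))"
    have "((\<lambda>s. x s - v) has_vector_derivative q t - x t) (at t within {0..})"
      using has_vector_derivative_diff[OF dx[OF t] has_vector_derivative_const] by simp
    moreover have "((\<lambda>s. y s - x s) has_vector_derivative (p t - y t) - (q t - x t)) (at t within {0..})"
      using has_vector_derivative_diff[OF dy[OF t] dx[OF t]] .
    ultimately have dW: "(W has_real_derivative D) (at t within {0..})"
      unfolding W_def D_def
      by (intro DERIV_add DERIV_cmult has_real_derivative_norm_square)
    have dU: "((\<lambda>s. exp (\<mu> * s) * W s) has_real_derivative exp (\<mu> * t) * (\<mu> * W t + D)) (at t within {0..})"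
      by (auto intro!: derivative_eq_intros dW simp: algebra_simps)
    \<comment> \<open>With \<mu> at most 1/2, the coefficient of the squared gap is at most 9/4 - 5
      + 5/2 = -1/4, which explains the weight 5. The other bound on \<mu> handles the distance to
      \<open>v\<close>.\<close>
    have nD: "\<mu> * W t + D \<le> 0"
    proof -
      have "2 * ((q t - x t) \<bullet> (x t - v))
          \<le> - (\<alpha> * \<eta> / 2) * (norm (x t - v))\<^sup>2 + 9 / 4 * (norm (y t - x t))\<^sup>2"
        unfolding q_def using assms(1-7) K[OF t] v
        by (intro projection_step_toward_solution) (auto simp: dist_norm)
      moreover have "2 * (((p t - y t) - (q t - x t)) \<bullet> (y t - x t)) \<le> - (norm (y t - x t))\<^sup>2"
        unfolding p_def q_def using assms K[OF t] by (intro projection_step_gap) auto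
      moreover have "\<mu> * (norm (x t - v))\<^sup>2 \<le> \<alpha> * \<eta> / 2 * (norm (x t - v))\<^sup>2"
        "\<mu> * (norm (y t - x t))\<^sup>2 \<le> 1 / 2 * (norm (y t - x t))\<^sup>2"
        by (intro mult_right_mono; simp add: \<mu>_def)+
      moreover have "\<mu> * W t = \<mu> * (norm (x t - v))\<^sup>2 + 5 * (\<mu> * (norm (y t - x t))\<^sup>2)"
        by (simp add: W_def algebra_simps)
      ultimately show ?thesis
        unfolding D_def using zero_le_power2[of "norm (y t - x t)"] by linarith
    qed
    have "G s \<le> exp (\<mu> * s) * W s" for s
      unfolding G_def V_def W_def z using infdist_le[OF v(1), of "x s"]
      by (auto intro!: power_mono simp: dist_norm infdist_nonneg)
    moreover have "exp (\<mu> * t) * W t = G t"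
      using v(2) by (simp add: G_def V_def W_def z dist_norm)
    moreover have "exp (\<mu> * t) * (\<mu> * W t + D) \<le> 0"
      using nD by (simp add: mult_le_0_iff)
    ultimately show "\<exists>U D. U t = G t \<and> (\<forall>s\<ge>0. G s \<le> U s) \<and>
        (U has_real_derivative D) (at t within {0..}) \<and> D \<le> 0"
      using dU by (intro exI[of _ "\<lambda>s. exp (\<mu> * s) * W s"] exI conjI) auto
  qed
  then show ?thesis
    by (simp add: G_def exp_minus field_simps)
qed

section \<open>Comparison of the Lyapunov function with the distance to the diagonal set\<close>

text \<open>For \<open>v\<close> nearest to \<open>x\<close>, the squared distance from the state to
  \<open>(v, v)\<close> is at most 3 times the squared distance of \<open>x\<close> plus 2 times the
  squared gap.\<close>

lemma infdist_diagonal_le: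
  fixes S :: "'a::euclidean_space set"
  assumes "closed S" "S \<noteq> {}"
  shows "(infdist (y, x) {(s, s) | s. s \<in> S})\<^sup>2 \<le> 3 * ((infdist x S)\<^sup>2 + 5 * (norm (y - x))\<^sup>2)"
proof -
  obtain v where v: "v \<in> S" "infdist x S = dist x v"
    using infdist_attains_inf[OF assms] by metis
  have "infdist (y, x) {(s, s) | s. s \<in> S} \<le> dist (y, x) (v, v)"
    using v by (intro infdist_le) auto
  then have "(infdist (y, x) {(s, s) | s. s \<in> S})\<^sup>2 \<le> (dist (y, x) (v, v))\<^sup>2"
    by (intro power_mono infdist_nonneg)
  moreover have "(dist (y, x) (v, v))\<^sup>2 = (norm (y - v))\<^sup>2 + (norm (x - v))\<^sup>2"
    by (simp add: dist_norm norm_Pair)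
  moreover have "(norm (y - v))\<^sup>2 \<le> (norm (y - x) + norm (x - v))\<^sup>2"
    using norm_triangle_ineq[of "y - x" "x - v"] by (intro power_mono) auto
  moreover have "\<dots> \<le> 2 * (norm (y - x))\<^sup>2 + 2 * (norm (x - v))\<^sup>2"
    using sum_squares_bound[of "norm (y - x)" "norm (x - v)"] by (simp add: power2_sum)
  ultimately show ?thesis
    using zero_le_power2[of "norm (y - x)"] unfolding v(2) dist_norm by argo
qed

lemma closed_diagonal:
  fixes S :: "'a::t2_space set"
  assumes "closed S"
  shows "closed {(s, s) | s. s \<in> S}"
proof -
  have "{(s, s) | s. s \<in> S} = fst -` S \<inter> {w. fst w = snd w}"
    by auto
  then show ?thesis
    by (simp add: closed_Int closed_vimage_fst assms closed_Collect_eq continuous_on_fst continuous_on_snd)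
qed

text \<open>For \<open>(v, v)\<close> nearest to the state, the gap is at most the sum of the
  distances of \<open>y\<close> and \<open>x\<close> to \<open>v\<close>. The coefficients are then
  10 for \<open>y\<close> and 1 + 10 = 11 for \<open>x\<close>.\<close>

lemma infdist_diagonal_ge:
  fixes S :: "'a::euclidean_space set"
  assumes "closed S" "S \<noteq> {}"
  shows "(infdist x S)\<^sup>2 + 5 * (norm (y - x))\<^sup>2 \<le> 11 * (infdist (y, x) {(s, s) | s. s \<in> S})\<^sup>2"
proof -
  have "closed {(s, s) | s. s \<in> S}"
    using assms by (intro closed_diagonal)
  then obtain v where v: "v \<in> S" "infdist (y, x) {(s, s) | s. s \<in> S} = dist (y, x) (v, v)"
    using infdist_attains_inf[of "{(s, s) | s. s \<in> S}" "(y, x)"] assms by auto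
  have "(infdist x S)\<^sup>2 \<le> (norm (x - v))\<^sup>2"
    using infdist_le[OF v(1), of x] by (intro power_mono infdist_nonneg) (simp add: dist_norm)
  moreover have "(norm (y - x))\<^sup>2 \<le> (norm (y - v) + norm (x - v))\<^sup>2"
    using norm_triangle_ineq4[of "y - v" "x - v"] by (intro power_mono) auto
  moreover have "\<dots> \<le> 2 * (norm (y - v))\<^sup>2 + 2 * (norm (x - v))\<^sup>2"
    using sum_squares_bound[of "norm (y - v)" "norm (x - v)"] by (simp add: power2_sum)
  moreover have "(dist (y, x) (v, v))\<^sup>2 = (norm (y - v))\<^sup>2 + (norm (x - v))\<^sup>2"
    by (simp add: dist_norm norm_Pair)
  ultimately show ?thesis
    using zero_le_power2[of "norm (y - v)"] unfolding v(2) by argo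
qed

theorem theorem4:
  fixes K :: "(real ^ 'm) set" and F :: "real ^ 'm \<Rightarrow> real ^ 'm" and L \<eta> \<alpha> :: real
  assumes "closed K" and "convex K"
    and "L > 0" and "L-lipschitz_on K F"
    and "VI_Sol K F \<noteq> {}"
    and "\<eta> > 0"
    and "\<forall>x\<in>K. \<exists>v \<in> nearest_points (closure (VI_Sol K F)) x.
           (F x - F v) \<bullet> (x - v) \<ge> \<eta> * (infdist x (VI_Sol K F))\<^sup>2"
    and "0 < \<alpha>" and "\<alpha> < min (\<eta> / L\<^sup>2) (1 / (2 * L))"
  shows "exponentially_stable (extragradient_field K F \<alpha>) (K \<times> K)
           {(xs, xs) | xs. xs \<in> VI_Sol K F}"
proof -
  let ?S = "VI_Sol K F" and ?f = "extragradient_field K F \<alpha>"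
  let ?M = "{(xs, xs) | xs. xs \<in> ?S}"
  define \<mu> where "\<mu> = min (\<alpha> * \<eta> / 2) (1 / 2)"
  have clS: "closed ?S"
    using assms by (intro closed_VI_Sol lipschitz_on_continuous_on)
  \<comment> \<open>The first bound makes the gap between \<open>y\<close> and \<open>x\<close>
    contract; the second lets the error bound absorb the Lipschitz remainders.\<close>
  have \<alpha>: "\<alpha> * L \<le> 1 / 2" "\<alpha> * L\<^sup>2 \<le> \<eta>"
    using assms by (auto simp: field_simps)
  have err: "\<exists>v \<in> ?S. dist x v = infdist x ?S \<and> (F x - F v) \<bullet> (x - v) \<ge> \<eta> * (infdist x ?S)\<^sup>2"
    if "x \<in> K" for x
    using assms(7) that clS by (fastforce simp: nearest_points_def closure_closed)
  \<comment> \<open>The two comparisons contribute 3 * 11 = 33, rounded up to the square 36; taking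
    square roots yields 6 and halves the rate.\<close>
  have decay: "infdist (z t) ?M \<le> 6 * infdist (z 0) ?M * exp (- (\<mu> / 2) * t)"
    if z: "is_solution ?f (K \<times> K) z" and "t \<ge> 0" for z t
  proof (rule power2_le_imp_le)
    let ?V = "\<lambda>(y, x). (infdist x ?S)\<^sup>2 + 5 * (norm (y - x))\<^sup>2"
    have "(infdist (z t) ?M)\<^sup>2 \<le> 3 * ?V (z t)"
      using infdist_diagonal_le[OF clS assms(5), of "fst (z t)" "snd (z t)"]
      by (simp add: case_prod_beta)
    also have "?V (z t) \<le> ?V (z 0) * exp (- \<mu> * t)"
      unfolding \<mu>_def using assms(1,2,4,6,8) \<alpha> assms(5) err z \<open>t \<ge> 0\<close> by (rule lyapunov_decay)
    also have "?V (z 0) \<le> 11 * (infdist (z 0) ?M)\<^sup>2"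
      using infdist_diagonal_ge[OF clS assms(5), of "snd (z 0)" "fst (z 0)"]
      by (simp add: case_prod_beta)
    finally have "(infdist (z t) ?M)\<^sup>2 \<le> 33 * ((infdist (z 0) ?M)\<^sup>2 * exp (- \<mu> * t))"
      by simp
    also have "\<dots> \<le> 36 * ((infdist (z 0) ?M)\<^sup>2 * exp (- \<mu> * t))"
      by (intro mult_right_mono) auto
    also have "exp (- \<mu> * t) = (exp (- (\<mu> / 2) * t))\<^sup>2"
      by (simp flip: exp_double)
    finally show "(infdist (z t) ?M)\<^sup>2 \<le> (6 * infdist (z 0) ?M * exp (- (\<mu> / 2) * t))\<^sup>2"
      by (simp add: power_mult_distrib mult_ac)
  qed (simp add: infdist_nonneg)
  have clM: "closed ?M"
    using clS by (rule closed_diagonal)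
  \<comment> \<open>Invariance is the decay estimate at initial distance 0: the distance stays 0,
    and \<open>?M\<close> is closed and nonempty.\<close>
  have "z t \<in> ?M" if "is_solution ?f (K \<times> K) z" "z 0 \<in> ?M" "t \<ge> 0" for z t
  proof -
    have "infdist (z t) ?M = 0"
      using decay[OF that(1,3)] that(2) infdist_nonneg[of "z t" ?M] by (simp del: mem_Collect_eq)
    then show ?thesis
      using in_closed_iff_infdist_zero[OF clM] assms(5) by blast
  qed
  then have "positively_invariant ?f (K \<times> K) ?M"
    unfolding positively_invariant_def by blast
  moreover have "\<mu> / 2 > 0"
    using assms by (simp add: \<mu>_def)
  ultimately show ?thesis
    unfolding exponentially_stable_def using clM decay
    \<comment> \<open>\<open>decay\<close> holds for every initial distance, so any positive radius
      serves as \<open>\<beta>3\<close>; here it is 1.\<close>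
    by (intro conjI exI[of _ 6] exI[of _ "\<mu> / 2"] exI[of _ 1]) auto
qed

end
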